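(* For every prime $p>2$, \[ \sum_{n=0}^{p-1}\frac{(-1)^n(172n^2+75n+9)}{2^{12n}}\binom{4n}{2n}\binom{3n}{n}\binom{2n}{n}^3\equiv 0\pmod{p}. \]
   Context: For rational numbers $x,y$ and a prime $p$, $x\equiv y\pmod{p^r}$ means that $x-y$ is a rational number whose $p$-adic valuation is at least $r$. *)

theory Defs
  imports "HOL-Computational_Algebra.Computational_Algebra"
begin

(* Only meaningful for x \<noteq> 0; the value at 0, conventionally \<infinity>, is handled in rat_cong. *)
definition padic_val :: "nat \<Rightarrow> rat \<Rightarrow> int" where
  "padic_val p x =
     int (multiplicity (int p) (fst (quotient_of x)))
     - int (multiplicity (int p) (snd (quotient_of x)))"

(* Congruence of x and y modulo p^r; the disjunct x = y is the case of infinite valuation. *)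
definition rat_cong :: "nat \<Rightarrow> nat \<Rightarrow> rat \<Rightarrow> rat \<Rightarrow> bool" where
  "rat_cong p r x y \<longleftrightarrow> x = y \<or> padic_val p (x - y) \<ge> int r"

end

theory Submission
  imports Defs
begin

text \<open>
  The summand is \<open>G(n, 0)\<close> for a Wilf--Zeilberger pair
  \<open>F(n + 1, k) - F(n, k) = G(n, k + 1) - G(n, k)\<close> with \<open>F(0, k) = 0\<close>.
  Let \<open>p = 2h + 1\<close> and let \<open>N\<close> be the least number with \<open>4N \<ge> p\<close>.
  For \<open>N \<le> n < p\<close> the summand is divisible by \<open>p\<close> because \<open>p\<close> divides
  \<open>binom(4n, 2n)\<close> or \<open>binom(2n, n)\<close>.
  Summing the relation over \<open>n < N\<close>, the sum of \<open>G(n, k)\<close> changes by \<open>F(N, k)\<close> when \<open>k\<close>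
  grows by 1, and \<open>F(N, k)\<close> contains the factor \<open>binom(4N, 2N)\<close>; so for \<open>k < h\<close> the sum is
  constant modulo \<open>p\<close>. At \<open>k = h\<close> every \<open>G(n, h)\<close> vanishes modulo \<open>p\<close>, through
  \<open>binom(2(n+h), n+h)\<close> for \<open>n > 0\<close> and through \<open>2h + 1\<close> for \<open>n = 0\<close>.
\<close>

section \<open>A Wilf--Zeilberger pair\<close>

text \<open>
  The pair comes from Dougall's \<open>5F4\<close> summation with parameters
  \<open>a = b = c = 1/2\<close>, \<open>d = 2n\<close>, its summation index shifted to \<open>k + n\<close>;
  the polynomial in \<open>G\<close> was found by solving Gosper's equation in \<open>k\<close>.
\<close>

definition wz_base :: "nat \<Rightarrow> nat \<Rightarrow> rat" where
  "wz_base n k = (-1) ^ n * of_nat ((2 * (n + k)) choose (n + k)) ^ 3 * of_nat ((4 * n) choose (2 * n))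
     * fact (3 * n + k)
     / (fact (2 * n) * fact n * 4096 ^ n * 32 ^ k * (\<Prod>j<k. 2 * of_nat j + 1 - 2 * of_nat n))"

definition wz_poly :: "rat \<Rightarrow> rat \<Rightarrow> rat" where
  "wz_poly x y = - (9*x + 129*x^2 + 730*x^3 + 2004*x^4 + 2664*x^5 + 1376*x^6)
     - (3 + 70*x + 538*x^2 + 1752*x^3 + 2552*x^4 + 1376*x^5) * y
     + (576*x^4 + 336*x^3 - 96*x^2 - 78*x - 9) * y^2
     + (2 + 120*x + 624*x^2 + 832*x^3) * y^3
     + (20 + 152*x + 288*x^2) * y^4 + (8 + 32*x) * y^5"

text \<open>Up to sign, \<open>2n - 1 - 2k\<close> is the factor \<open>j = k\<close> that the
  product in \<open>wz_base\<close> does not yet contain, and \<open>3n + k\<close> cancels the top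
  factor of \<open>fact (3 * n + k)\<close>.\<close>

definition wz_F :: "nat \<Rightarrow> nat \<Rightarrow> rat" where
  "wz_F n k = 384 * of_nat n ^ 3 * (4 * of_nat (n + k) + 1)
     / ((2 * of_nat n - 1 - 2 * of_nat k) * of_nat (3 * n + k)) * wz_base n k"

text \<open>
  At \<open>n = 0\<close> the general expression for \<open>G\<close> still makes sense for \<open>k > 0\<close>, but reads
  0/0 at \<open>k = 0\<close>; the separate clause is its value with the common factor \<open>k\<close> cancelled.
\<close>

definition wz_G :: "nat \<Rightarrow> nat \<Rightarrow> rat" where
  "wz_G n k = (if n = 0
     then - 3 * (2 * of_nat k + 1)^2 * (2 * of_nat k ^ 2 + 3 * of_nat k - 3) * wz_base n k
     else - 3 * wz_poly (of_nat n) (of_nat k)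
            / ((2 * of_nat n + 1) ^ 3 * of_nat (3 * n + k)) * wz_base n k)"

section \<open>Shift quotients of the hypergeometric term\<close>

definition ratio_k :: "rat \<Rightarrow> rat \<Rightarrow> rat" where
  "ratio_k x y = (2*(x+y)+1)^3 * (3*x+y+1) / (4 * (x+y+1)^3 * (2*y+1-2*x))"

definition ratio_n :: "rat \<Rightarrow> rat \<Rightarrow> rat" where
  "ratio_n x y = - ((2*(x+y)+1)^3 * (4*x+1) * (4*x+3) * (3*x+y+1) * (3*x+y+2) * (3*x+y+3) * (2*x+1-2*y))
     / (512 * (x+y+1)^3 * (2*x+1)^3 * (x+1)^3)"

text \<open>Parity: an odd integer is not 0. So no denominator of the product vanishes, whichever of
  \<open>n\<close> and \<open>k\<close> is larger.\<close>

lemma odd_diff_nonzero: "2 * of_nat j + 1 - 2 * of_nat n \<noteq> (0::rat)"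
proof -
  have "2 * int j + 1 - 2 * int n \<noteq> 0" by presburger
  then have "of_int (2 * int j + 1 - 2 * int n) \<noteq> (0::rat)" by (simp only: of_int_eq_0_iff not_False_eq_True)
  then show ?thesis by simp
qed

lemma central_binomial_Suc:
  "of_nat ((2 * Suc m) choose (Suc m)) = (of_nat ((2 * m) choose m) * 2 * (2 * of_nat m + 1) / (of_nat m + 1) :: rat)"
proof -
  have nz: "of_nat m + 1 \<noteq> (0::rat)"
    by (metis of_nat_Suc of_nat_neq_0 add.commute)
  define f g :: rat where "f = fact (2 * m)" and "g = fact m"
  have g: "g \<noteq> 0" by (simp add: g_def)
  have f1: "fact (2 * Suc m) = (2 * of_nat m + 2) * ((2 * of_nat m + 1) * f)"
    by (simp add: f_def ac_simps)
  have g1: "fact (Suc m) = (of_nat m + 1) * g"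
    by (simp add: g_def)
  have C: "of_nat ((2 * l) choose l) = (fact (2 * l) / (fact l * fact l) :: rat)" for l
    by (subst binomial_fact) (simp_all add: mult_2)
  show ?thesis
    unfolding C f1 g1 unfolding f_def[symmetric] g_def[symmetric]
    using nz g by (simp add: divide_simps)
qed

lemma central_binomial_four_Suc:
  "of_nat ((4 * Suc n) choose (2 * Suc n))
   = (of_nat ((4 * n) choose (2 * n)) * 4 * (4 * of_nat n + 1) * (4 * of_nat n + 3)
      / ((2 * of_nat n + 1) * (2 * of_nat n + 2)) :: rat)"
proof -
  have "of_nat ((4 * Suc n) choose (2 * Suc n)) = (of_nat ((2 * Suc (Suc (2*n))) choose (Suc (Suc (2*n)))) :: rat)"
    by (rule arg_cong[where f = of_nat], rule arg_cong2[where f = binomial]) simp_all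
  also have "\<dots> = of_nat ((2 * (2*n)) choose (2*n)) * 2 * (2 * of_nat (2*n) + 1) / (of_nat (2*n) + 1)
       * 2 * (2 * of_nat (Suc (2*n)) + 1) / (of_nat (Suc (2*n)) + 1)"
    by (simp only: central_binomial_Suc)
  also have "\<dots> = of_nat ((4 * n) choose (2 * n)) * 4 * (4 * of_nat n + 1) * (4 * of_nat n + 3)
      / ((2 * of_nat n + 1) * (2 * of_nat n + 2))"
    by (simp add: algebra_simps)
  finally show ?thesis .
qed

text \<open>Raising \<open>n\<close> by 1 moves each factor to its predecessor in the progression of
  step 2, so the two products differ only in their end factors \<open>2k - 1 - 2n\<close> and
  \<open>-1 - 2n\<close>.\<close>

lemma odd_prod_shift:
  "(\<Prod>j<k. 2 * of_nat j + 1 - 2 * of_nat (Suc n)) * (2 * of_nat n + 1 - 2 * of_nat k)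
   = (\<Prod>j<k. 2 * of_nat j + 1 - 2 * of_nat n) * (2 * of_nat n + 1 :: rat)"
  by (induction k) (simp_all add: algebra_simps)

lemma wz_base_Suc_right: "wz_base n (Suc k) = wz_base n k * ratio_k (of_nat n) (of_nat k)"
proof -
  have nz: "of_nat n + of_nat k + 1 \<noteq> (0::rat)"
    by (metis of_nat_Suc of_nat_add of_nat_neq_0 add.commute)
  have c: "of_nat ((2 * (n + Suc k)) choose (n + Suc k)) =
     (of_nat ((2 * (n + k)) choose (n + k)) * 2 * (2 * (of_nat n + of_nat k) + 1) / (of_nat n + of_nat k + 1) :: rat)"
    using central_binomial_Suc[of "n + k"] by simp
  have f: "fact (3 * n + Suc k) = (3 * of_nat n + of_nat k + 1) * (fact (3 * n + k) :: rat)"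
    by (simp add: algebra_simps)
  show ?thesis
    unfolding wz_base_def ratio_k_def c f prod.lessThan_Suc power_Suc
    using nz odd_diff_nonzero[of k n]
    by (simp add: power_mult_distrib power_divide divide_simps)
qed

lemma wz_base_Suc_left: "wz_base (Suc n) k = wz_base n k * ratio_n (of_nat n) (of_nat k)"
proof -
  define x y :: rat where "x = of_nat n" and "y = of_nat k"
  have x0: "x \<ge> 0" and y0: "y \<ge> 0" by (simp_all add: x_def y_def)
  define P Q :: rat where "P = (\<Prod>j<k. 2 * of_nat j + 1 - 2 * of_nat n)"
    and "Q = (\<Prod>j<k. 2 * of_nat j + 1 - 2 * of_nat (Suc n))"
  have d: "2 * x + 1 - 2 * y \<noteq> 0"
    using odd_diff_nonzero[of n k] by (simp add: x_def y_def)
  have PQ: "Q = P * (2 * x + 1) / (2 * x + 1 - 2 * y)"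
    using odd_prod_shift[of n k] d unfolding P_def Q_def x_def y_def by (simp add: divide_simps)
  have P0: "P \<noteq> 0" unfolding P_def using odd_diff_nonzero[of _ n] by (subst prod_zero_iff) blast+
  define C D E f2 f1 :: rat where "C = of_nat ((2 * (n + k)) choose (n + k))"
    and "D = of_nat ((4 * n) choose (2 * n))" and "E = fact (3 * n + k)"
    and "f2 = fact (2 * n)" and "f1 = fact n"
  have c: "of_nat ((2 * (Suc n + k)) choose (Suc n + k)) = C * 2 * (2 * (x + y) + 1) / (x + y + 1)"
    using central_binomial_Suc[of "n + k"] by (simp add: C_def x_def y_def)
  have e: "fact (3 * Suc n + k) = (3 * x + y + 1) * (3 * x + y + 2) * (3 * x + y + 3) * E"
    by (simp add: E_def x_def y_def numeral_eq_Suc algebra_simps)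
  have g: "fact (2 * Suc n) = (2 * x + 1) * (2 * x + 2) * f2"
    by (simp add: f2_def x_def algebra_simps)
  have h: "fact (Suc n) = (x + 1) * f1"
    by (simp add: f1_def x_def algebra_simps)
  have dd: "of_nat ((4 * Suc n) choose (2 * Suc n)) = D * 4 * (4 * x + 1) * (4 * x + 3) / ((2 * x + 1) * (2 * x + 2))"
    unfolding D_def x_def by (rule central_binomial_four_Suc)
  have nz: "x + y + 1 \<noteq> 0" "2 * x + 1 \<noteq> 0" "2 * x + 2 \<noteq> 0" "x + 1 \<noteq> 0" "f2 \<noteq> 0" "f1 \<noteq> 0"
    using x0 y0 by (simp_all add: f2_def f1_def)
  have "wz_base (Suc n) k = (-1) ^ Suc n * (C * 2 * (2 * (x + y) + 1) / (x + y + 1)) ^ 3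
      * (D * 4 * (4 * x + 1) * (4 * x + 3) / ((2 * x + 1) * (2 * x + 2)))
      * ((3 * x + y + 1) * (3 * x + y + 2) * (3 * x + y + 3) * E)
      / ((2 * x + 1) * (2 * x + 2) * f2 * ((x + 1) * f1) * 4096 ^ Suc n * 32 ^ k
          * (P * (2 * x + 1) / (2 * x + 1 - 2 * y)))"
    unfolding wz_base_def c e g h dd Q_def[symmetric] PQ ..
  also have "\<dots> = (-1) ^ n * C ^ 3 * D * E / (f2 * f1 * 4096 ^ n * 32 ^ k * P) * ratio_n x y"
  proof -
    \<comment> \<open>With \<open>x + 1\<close> as the only such factor, the denominators from
      \<open>choose\<close> and \<open>fact\<close> merge into the cube in
      \<open>ratio_n\<close>.\<close>
    have e2: "2 * x + 2 = 2 * (x + 1)" by simp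
    show ?thesis
      unfolding ratio_n_def e2 using nz d P0
      by (simp add: power_mult_distrib power_divide divide_simps) (simp add: algebra_simps power3_eq_cube)
  qed
  finally show ?thesis
    by (simp only: wz_base_def C_def D_def E_def f2_def f1_def P_def x_def y_def)
qed

text \<open>By the shift quotients all four terms are rational multiples of \<open>X\<close>, so the
  claim becomes a polynomial identity in \<open>x\<close> and \<open>y\<close>. The case
  \<open>n = 0\<close> is separate because \<open>wz_G\<close> has its own clause there.\<close>

lemma wz_pair: "wz_F (Suc n) k - wz_F n k = wz_G n (Suc k) - wz_G n k"
proof -
  define x y :: rat where "x = of_nat n" and "y = of_nat k"
  define X where "X = wz_base n k"
  have x0: "x \<ge> 0" and y0: "y \<ge> 0" by (simp_all add: x_def y_def)
  have d: "2 * x + 1 - 2 * y \<noteq> 0" "2 * y + 1 - 2 * x \<noteq> 0" "2 * x - 1 - 2 * y \<noteq> 0"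
    using odd_diff_nonzero[of n k] odd_diff_nonzero[of k n] by (simp_all add: x_def y_def)
  have nz: "x + y + 1 \<noteq> 0" "2 * x + 1 \<noteq> 0" "x + 1 \<noteq> 0" "3 * x + y + 1 \<noteq> 0" "3 * x + y + 3 \<noteq> 0"
    using x0 y0 by simp_all
  \<comment> \<open>The factors \<open>(x+1)^3\<close>, \<open>2*x+1-2*y\<close> and
    \<open>3*x+y+3\<close> cancel against \<open>ratio_n\<close>, and 384/512 = 3/4.\<close>
  have F1: "wz_F (Suc n) k = - (3 * (4*(x+y)+5) * (2*(x+y)+1)^3 * (4*x+1) * (4*x+3) * (3*x+y+1) * (3*x+y+2))
     / (4 * (x+y+1)^3 * (2*x+1)^3) * X"
  proof -
    have "wz_F (Suc n) k = 384 * (x+1)^3 * (4*(x+y)+5) / ((2*x+1-2*y) * (3*x+y+3)) * (X * ratio_n x y)"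
      unfolding wz_F_def wz_base_Suc_left X_def x_def y_def by (simp add: algebra_simps)
    also have "\<dots> = - (3 * (4*(x+y)+5) * (2*(x+y)+1)^3 * (4*x+1) * (4*x+3) * (3*x+y+1) * (3*x+y+2))
     / (4 * (x+y+1)^3 * (2*x+1)^3) * X"
      unfolding ratio_n_def using nz d by (simp add: divide_simps)
    finally show ?thesis .
  qed
  show ?thesis
  proof (cases "n = 0")
    case True
    then have "x = 0" by (simp add: x_def)
    have G0: "wz_G n k = - 3 * (2 * y + 1)^2 * (2 * y ^ 2 + 3 * y - 3) * X"
      unfolding wz_G_def X_def y_def using True by simp
    have G1: "wz_G n (Suc k) = - 3 * (2 * y + 3)^2 * (2 * (y + 1) ^ 2 + 3 * (y + 1) - 3) * (X * ratio_k x y)"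
      unfolding wz_G_def wz_base_Suc_right X_def y_def x_def using True by (simp add: algebra_simps)
    have F0: "wz_F n k = 0" using True by (simp add: wz_F_def)
    have y1: "y + 1 \<noteq> 0" "2 * y + 1 \<noteq> 0" using y0 by simp_all
    show ?thesis unfolding G0 G1 F0 F1 ratio_k_def \<open>x = 0\<close>
      using y1 by (simp add: divide_simps) algebra
  next
    case False
    then have xp: "x > 0" by (simp add: x_def)
    then have nz2: "3 * x + y \<noteq> 0" using y0 by simp
    have G0: "wz_G n k = - 3 * wz_poly x y / ((2*x+1)^3 * (3*x+y)) * X"
      unfolding wz_G_def X_def y_def x_def using False by simp
    have G1: "wz_G n (Suc k) = - 3 * wz_poly x (y + 1) / ((2*x+1)^3 * (3*x+y+1)) * (X * ratio_k x y)"
      unfolding wz_G_def wz_base_Suc_right X_def y_def x_def using False by (simp add: algebra_simps)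
    have G1': "wz_G n (Suc k) = - 3 * wz_poly x (y + 1) * (2*(x+y)+1)^3 / (4 * (2*x+1)^3 * (x+y+1)^3 * (2*y+1-2*x)) * X"
      unfolding G1 ratio_k_def using nz d by (simp add: divide_simps)
    have F0: "wz_F n k = - 384 * x^3 * (4*(x+y)+1) / ((2*y+1-2*x) * (3*x+y)) * X"
      unfolding wz_F_def X_def y_def x_def using d nz2 by (simp add: divide_simps x_def y_def algebra_simps)
    \<comment> \<open>Denominators are cleared by hand over \<open>4 * a * b * u * v\<close>, with
      \<open>a = (x+y+1)^3\<close>, \<open>b = (2*x+1)^3\<close>, \<open>u = 2*y+1-2*x\<close> and
      \<open>v = 3*x+y\<close>; \<open>algebra\<close> then sees only polynomials.\<close>
    have gen: "p / (4 * a * b) * X - q / (u * v) * X = r / (4 * b * a * u) * X - s / (b * v) * X"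
      if "p * (u * v) - q * (4 * a * b) = r * v - s * (4 * a * u)"
        and "a \<noteq> 0" "b \<noteq> 0" "u \<noteq> 0" "v \<noteq> 0" for p q r s a b u v :: rat
    proof -
      have "p / (4 * a * b) - q / (u * v) = (p * (u * v) - q * (4 * a * b)) / (4 * a * b * u * v)"
        using that(2-) by (simp add: field_simps)
      also have "\<dots> = (r * v - s * (4 * a * u)) / (4 * a * b * u * v)" using that(1) by simp
      also have "\<dots> = r / (4 * b * a * u) - s / (b * v)"
        using that(2-) by (simp add: field_simps)
      finally show ?thesis by (metis left_diff_distrib)
    qed
    show ?thesis unfolding F1 F0 G0 G1'
    proof (rule gen)
      show "- (3 * (4*(x+y)+5) * (2*(x+y)+1)^3 * (4*x+1) * (4*x+3) * (3*x+y+1) * (3*x+y+2)) * ((2*y+1-2*x) * (3*x+y))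
       - - 384 * x^3 * (4*(x+y)+1) * (4 * (x+y+1)^3 * (2*x+1)^3)
       = - 3 * wz_poly x (y + 1) * (2*(x+y)+1)^3 * (3*x+y) - - 3 * wz_poly x y * (4 * (x+y+1)^3 * (2*y+1-2*x))"
        unfolding wz_poly_def by algebra
    qed (use nz nz2 d in simp_all)
  qed
qed

lemma wz_F_0: "wz_F 0 k = 0"
  by (simp add: wz_F_def)

text \<open>At \<open>y = 0\<close> the polynomial splits off \<open>x\<close> and
  \<open>(2*x+1)^3\<close>, which cancel the denominator and leave the quadratic factor of the
  summand.\<close>

lemma wz_G_0:
  "wz_G n 0 = (-1) ^ n * (172 * of_nat n ^ 2 + 75 * of_nat n + 9) / 2 ^ (12 * n)
       * of_nat ((4 * n) choose (2 * n)) * of_nat ((3 * n) choose n)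
       * of_nat ((2 * n) choose n) ^ 3"
proof -
  have B: "wz_base n 0 = (-1) ^ n / 2 ^ (12 * n) * of_nat ((4 * n) choose (2 * n))
     * of_nat ((3 * n) choose n) * of_nat ((2 * n) choose n) ^ 3"
  proof -
    have "of_nat ((3 * n) choose n) = (fact (3 * n) / (fact n * fact (2 * n)) :: rat)"
      by (subst binomial_fact) simp_all
    moreover have "(2::rat) ^ (12 * n) = 4096 ^ n"
      by (simp add: power_mult)
    ultimately show ?thesis
      by (simp add: wz_base_def ac_simps)
  qed
  show ?thesis
  proof (cases "n = 0")
    case True
    then show ?thesis by (simp add: wz_G_def wz_base_def)
  next
    case False
    define x :: rat where "x = of_nat n"
    have x: "x > 0" using False by (simp add: x_def)
    have "wz_poly x 0 = - (x * (2 * x + 1) ^ 3 * (172 * x ^ 2 + 75 * x + 9))"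
      unfolding wz_poly_def by simp algebra
    then have "- 3 * wz_poly x 0 / ((2 * x + 1) ^ 3 * (3 * x)) = 172 * x ^ 2 + 75 * x + 9"
      using x by (simp add: divide_simps)
    then have "wz_G n 0 = (172 * x ^ 2 + 75 * x + 9) * wz_base n 0"
      using False by (simp add: wz_G_def x_def)
    then show ?thesis by (simp add: B x_def)
  qed
qed

section \<open>Integrality at a prime\<close>

text \<open>For prime \<open>p\<close> this is the localization of the integers at \<open>p\<close>.
  Fractions need not be reduced and 0 is no special case, which makes the closure rules
  easy.\<close>

definition p_integral :: "nat \<Rightarrow> rat \<Rightarrow> bool" where
  "p_integral p x \<longleftrightarrow> (\<exists>a b. \<not> int p dvd b \<and> x = of_int a / of_int b)"

definition p_multiple :: "nat \<Rightarrow> rat \<Rightarrow> bool" where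
  "p_multiple p x \<longleftrightarrow> (\<exists>y. p_integral p y \<and> x = of_nat p * y)"

context
  fixes p :: nat
  assumes p: "prime p"
begin

lemma p_integral_of_int: "p_integral p (of_int a)"
  unfolding p_integral_def using p
  by (intro exI[of _ a] exI[of _ 1]) (auto simp: prime_nat_iff)

lemma p_integral_of_nat: "p_integral p (of_nat a)"
  using p_integral_of_int[of "int a"] by simp

lemma p_integral_numeral: "p_integral p (numeral a)"
  using p_integral_of_int[of "numeral a"] by simp

lemma p_integral_1: "p_integral p 1"
  using p_integral_of_int[of 1] by simp

lemma p_integral_mult:
  assumes "p_integral p x" "p_integral p y"
  shows "p_integral p (x * y)"
proof -
  obtain a b c d where "\<not> int p dvd b" "\<not> int p dvd d" "x = of_int a / of_int b" "y = of_int c / of_int d"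
    using assms unfolding p_integral_def by blast
  moreover from this have "\<not> int p dvd b * d"
    using p by (simp add: prime_dvd_mult_iff)
  ultimately show ?thesis
    unfolding p_integral_def by (intro exI[of _ "a * c"] exI[of _ "b * d"]) simp
qed

lemma p_integral_add:
  assumes "p_integral p x" "p_integral p y"
  shows "p_integral p (x + y)"
proof -
  obtain a b c d where *: "\<not> int p dvd b" "\<not> int p dvd d" "x = of_int a / of_int b" "y = of_int c / of_int d"
    using assms unfolding p_integral_def by blast
  then have "b \<noteq> 0" "d \<noteq> 0" by auto
  moreover from * have "\<not> int p dvd b * d"
    using p by (simp add: prime_dvd_mult_iff)
  ultimately show ?thesis
    unfolding p_integral_def using *
    by (intro exI[of _ "a * d + c * b"] exI[of _ "b * d"]) (simp add: field_simps)
qed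

lemma p_integral_uminus: "p_integral p x \<Longrightarrow> p_integral p (- x)"
  using p_integral_mult[OF p_integral_of_int[of "-1"]] by simp

lemma p_integral_diff: "p_integral p x \<Longrightarrow> p_integral p y \<Longrightarrow> p_integral p (x - y)"
  using p_integral_add[OF _ p_integral_uminus] by force

lemma p_integral_power: "p_integral p x \<Longrightarrow> p_integral p (x ^ n)"
  by (induction n) (auto intro: p_integral_1 p_integral_mult)

lemma p_integral_divide_of_int:
  "p_integral p x \<Longrightarrow> \<not> int p dvd b \<Longrightarrow> p_integral p (x / of_int b)"
  using p_integral_mult[of x "1 / of_int b"] unfolding p_integral_def[of _ "1 / of_int b"]
  by (metis mult.right_neutral of_int_1 times_divide_eq_right)

lemmas p_integral_intros = p_integral_of_int p_integral_of_nat p_integral_numeral p_integral_1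
  p_integral_mult p_integral_add p_integral_uminus p_integral_diff p_integral_power

lemma p_multiple_0: "p_multiple p 0"
  unfolding p_multiple_def using p_integral_of_int[of 0] by auto

lemma p_multiple_of_nat: "p dvd a \<Longrightarrow> p_multiple p (of_nat a)"
  unfolding p_multiple_def by (auto elim!: dvdE intro!: p_integral_of_nat)

lemma p_multiple_mult: "p_multiple p x \<Longrightarrow> p_integral p y \<Longrightarrow> p_multiple p (x * y)"
  unfolding p_multiple_def by (metis mult.assoc p_integral_mult)

lemma p_multiple_add: "p_multiple p x \<Longrightarrow> p_multiple p y \<Longrightarrow> p_multiple p (x + y)"
  unfolding p_multiple_def by (metis distrib_left p_integral_add)

lemma p_multiple_diff: "p_multiple p x \<Longrightarrow> p_multiple p y \<Longrightarrow> p_multiple p (x - y)"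
  unfolding p_multiple_def by (metis right_diff_distrib p_integral_diff)

lemma p_multiple_sum: "(\<And>i. i \<in> A \<Longrightarrow> p_multiple p (f i)) \<Longrightarrow> p_multiple p (sum f A)"
  by (induction A rule: infinite_finite_induct) (auto intro: p_multiple_0 p_multiple_add)

text \<open>The fraction given by \<open>quotient_of\<close> is in lowest terms, so once
  \<open>p\<close> divides its numerator it cannot divide its denominator.\<close>

lemma p_multiple_imp_rat_cong:
  assumes "p_multiple p x"
  shows "rat_cong p 1 x 0"
proof (cases "x = 0")
  case True
  then show ?thesis by (simp add: rat_cong_def)
next
  case False
  obtain a b where b: "\<not> int p dvd b" and x: "x = of_nat p * (of_int a / of_int b)"
    using assms unfolding p_multiple_def p_integral_def by blast
  obtain c d where cd: "quotient_of x = (c, d)" by (cases "quotient_of x")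
  have d: "d > 0" and cop: "coprime c d" and xcd: "x = of_int c / of_int d"
    using quotient_of_denom_pos[OF cd] quotient_of_coprime[OF cd] quotient_of_div[OF cd] by auto
  have "c \<noteq> 0" using False xcd by auto
  have "b \<noteq> 0" using b by auto
  then have "of_int (c * b) = (of_int (int p * a * d) :: rat)"
    using x xcd d by (simp add: field_simps)
  then have "c * b = int p * a * d" by (simp only: of_int_eq_iff)
  then have "int p dvd c * b" by simp
  then have pc: "int p dvd c" using b p by (simp add: prime_dvd_mult_iff)
  then have "\<not> int p dvd d"
    using cop p by (metis coprime_common_divisor not_prime_unit prime_nat_int_transfer)
  then have "multiplicity (int p) d = 0"
    by (rule not_dvd_imp_multiplicity_0)
  moreover have "multiplicity (int p) c \<ge> 1"
    using pc \<open>c \<noteq> 0\<close> p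
    by (intro multiplicity_geI) (auto simp: prime_nat_iff)
  ultimately show ?thesis
    unfolding rat_cong_def padic_val_def using cd by simp
qed

text \<open>The prime divides the factorial of \<open>2 * m\<close> but not that of
  \<open>m\<close>.\<close>

lemma prime_dvd_central_binomial:
  assumes "m < p" "p \<le> 2 * m"
  shows "p dvd ((2 * m) choose m)"
proof -
  have "p dvd fact (2 * m)"
    using assms p by (simp add: prime_dvd_fact_iff)
  moreover have "fact m * fact m * ((2 * m) choose m) = (fact (2 * m) :: nat)"
    using binomial_fact_lemma[of m "2 * m"] by (simp add: mult_2)
  moreover have "\<not> p dvd fact m"
    using assms p by (simp add: prime_dvd_fact_iff)
  ultimately show ?thesis
    using p by (metis prime_dvd_mult_iff)
qed

lemma not_dvd_small: "x \<noteq> 0 \<Longrightarrow> \<bar>x\<bar> < int p \<Longrightarrow> \<not> int p dvd x"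
  by (metis abs_dvd_iff dvd_abs_iff leD zdvd_imp_le zero_less_abs_iff)

section \<open>Divisibility of the pair by an odd prime\<close>

context
  assumes p_gt_2: "p > 2"
begin

lemma not_dvd_2: "\<not> int p dvd 2"
  using p_gt_2 by (intro not_dvd_small) auto

lemma not_dvd_power_2: "\<not> int p dvd 2 ^ m"
  using not_dvd_2 p by (metis prime_dvd_power prime_nat_int_transfer)

text \<open>All denominator factors are prime to \<open>p\<close>: factorials of numbers below
  \<open>p\<close>, powers of 2, and odd numbers of absolute value below \<open>p\<close>. The
  binomials are kept visible as sources of \<open>p\<close>; \<open>3 * n + k\<close> is kept to
  cancel the same denominator in \<open>wz_F\<close> and \<open>wz_G\<close>.\<close>

lemma wz_base_p_integral:
  assumes "2 * n < p" "2 * k < p" "3 * n + k > 0"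
  obtains w where "p_integral p w"
    "wz_base n k = of_nat ((2 * (n + k)) choose (n + k)) ^ 3 * of_nat ((4 * n) choose (2 * n))
       * of_nat (3 * n + k) * w"
proof -
  define b where "b = fact (2 * n) * fact n * 2 ^ (12 * n) * 2 ^ (5 * k) * (\<Prod>j<k. 2 * int j + 1 - 2 * int n)"
  define w :: rat where "w = of_int ((-1) ^ n * fact (3 * n + k - 1)) / of_int b"
  have pf: "\<not> int p dvd fact m" if "m < p" for m
  proof -
    have "\<not> p dvd fact m" using that p by (simp add: prime_dvd_fact_iff)
    then show ?thesis by (metis of_nat_fact of_nat_dvd_iff)
  qed
  have "\<not> int p dvd (\<Prod>j<k. 2 * int j + 1 - 2 * int n)"
  proof
    assume "int p dvd (\<Prod>j<k. 2 * int j + 1 - 2 * int n)"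
    then obtain j where "j < k" "int p dvd 2 * int j + 1 - 2 * int n"
      using p by (auto simp: prime_dvd_prod_iff)
    moreover have "2 * int j + 1 - 2 * int n \<noteq> 0" by presburger
    ultimately show False
      using not_dvd_small[of "2 * int j + 1 - 2 * int n"] assms by linarith
  qed
  then have "\<not> int p dvd b"
    unfolding b_def using p pf[of "2 * n"] pf[of n] assms(1)
    by (simp add: prime_dvd_mult_iff not_dvd_power_2)
  then have "p_integral p w"
    unfolding w_def by (intro p_integral_divide_of_int p_integral_of_int)
  moreover have "fact (3 * n + k) = (of_nat (3 * n + k) * fact (3 * n + k - 1) :: rat)"
    using assms(3) by (rule fact_reduce)
  moreover have "(2::rat) ^ (12 * n) = 4096 ^ n" "(2::rat) ^ (5 * k) = 32 ^ k"
    by (simp_all add: power_mult)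
  ultimately show thesis
    by (intro that[of w]) (simp_all add: wz_base_def w_def b_def)
qed

text \<open>The factor \<open>p\<close> comes from \<open>(4 * n) choose (2 * n)\<close>. The
  denominator \<open>3 * n + k\<close> may be divisible by \<open>p\<close>, so it must cancel
  exactly; the other one, \<open>q\<close>, is odd with absolute value below
  \<open>p\<close>.\<close>

lemma wz_F_p_multiple:
  assumes "n > 0" "2 * n < p" "p \<le> 4 * n" "2 * k + 1 < p"
  shows "p_multiple p (wz_F n k)"
proof -
  obtain w where w: "p_integral p w"
    "wz_base n k = of_nat ((2 * (n + k)) choose (n + k)) ^ 3 * of_nat ((4 * n) choose (2 * n))
       * of_nat (3 * n + k) * w"
    using wz_base_p_integral[of n k] assms by auto
  define q where "q = 2 * int n - 1 - 2 * int k"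
  have "q \<noteq> 0" unfolding q_def by presburger
  then have q: "\<not> int p dvd q"
    using assms unfolding q_def by (intro not_dvd_small) linarith+
  have eq: "wz_F n k = of_nat ((4 * n) choose (2 * n)) * (384 * of_nat n ^ 3 * (4 * of_nat (n + k) + 1)
     * of_nat ((2 * (n + k)) choose (n + k)) ^ 3 * w / of_int q)"
  proof -
    have "of_nat (3 * n + k) \<noteq> (0::rat)" using assms(1) by (simp only: of_nat_eq_0_iff)
    moreover have "(2 * of_nat n - 1 - 2 * of_nat k :: rat) = of_int q" by (simp add: q_def)
    ultimately show ?thesis unfolding wz_F_def w(2) by simp
  qed
  have "p dvd ((4 * n) choose (2 * n))"
    using prime_dvd_central_binomial[of "2 * n"] assms by simp
  then show ?thesis
    unfolding eq
    by (intro p_multiple_mult p_multiple_of_nat p_integral_divide_of_int p_integral_intros w(1) q)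
qed

lemma wz_G_p_multiple:
  assumes "4 * n < p" and h: "p = 2 * h + 1"
  shows "p_multiple p (wz_G n h)"
proof -
  have "h > 0" using h p_gt_2 by simp
  then obtain w where w: "p_integral p w"
    "wz_base n h = of_nat ((2 * (n + h)) choose (n + h)) ^ 3 * of_nat ((4 * n) choose (2 * n))
       * of_nat (3 * n + h) * w"
    using wz_base_p_integral[of n h] assms by auto
  show ?thesis
  proof (cases "n = 0")
    case True
    \<comment> \<open>Here \<open>2 * h + 1 = p\<close>, so the square in the clause for
      \<open>n = 0\<close> is \<open>p^2\<close>; one \<open>p\<close> is split off.\<close>
    have eq: "wz_G n h = of_nat p * (- 3 * of_nat p * (2 * of_nat h ^ 2 + 3 * of_nat h - 3) * wz_base n h)"
      using True by (simp add: wz_G_def h power2_eq_square) (simp add: algebra_simps)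
    show ?thesis unfolding eq w(2)
      by (intro p_multiple_mult p_multiple_of_nat p_integral_intros w(1) dvd_refl)
  next
    case False
    have "int p dvd 2 * int n + 1 \<Longrightarrow> False"
      using not_dvd_small[of "2 * int n + 1"] assms(1) False by linarith
    then have q: "\<not> int p dvd (2 * int n + 1) ^ 3"
      using p by (metis prime_dvd_power prime_nat_int_transfer)
    have "of_nat (3 * n + h) \<noteq> (0::rat)" using \<open>h > 0\<close> by (simp only: of_nat_eq_0_iff)
    then have eq: "wz_G n h = of_nat ((2 * (n + h)) choose (n + h)) *
       (- 3 * wz_poly (of_nat n) (of_nat h) * of_nat ((2 * (n + h)) choose (n + h)) ^ 2
         * of_nat ((4 * n) choose (2 * n)) * w / of_int ((2 * int n + 1) ^ 3))"
      using False unfolding wz_G_def w(2) by (simp add: power2_eq_square power3_eq_cube ac_simps)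
    \<comment> \<open>Since \<open>2 * (n + h) = p + 2 * n - 1\<close>, the bound
      \<open>p <= 2 * (n + h)\<close> needs \<open>n > 0\<close>.\<close>
    have "p dvd ((2 * (n + h)) choose (n + h))"
      using assms False by (intro prime_dvd_central_binomial) auto
    then show ?thesis
      unfolding eq wz_poly_def
      by (intro p_multiple_mult p_multiple_of_nat p_integral_divide_of_int p_integral_intros w(1) q)
  qed
qed

text \<open>If \<open>2 * n < p\<close> the first binomial supplies \<open>p\<close>, otherwise the
  second does. The explicit summand is used because \<open>wz_base_p_integral\<close> covers only
  \<open>2 * n < p\<close>.\<close>

lemma wz_G_0_p_multiple:
  assumes "n < p" "p \<le> 4 * n"
  shows "p_multiple p (wz_G n 0)"
proof -
  have dvd: "p dvd ((4 * n) choose (2 * n)) * ((2 * n) choose n) ^ 3"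
  proof (cases "2 * n < p")
    case True
    then show ?thesis using prime_dvd_central_binomial[of "2 * n"] assms by simp
  next
    case False
    then show ?thesis using prime_dvd_central_binomial[of n] assms by (simp add: power3_eq_cube)
  qed
  have eq: "wz_G n 0 = of_nat (((4 * n) choose (2 * n)) * ((2 * n) choose n) ^ 3)
      * ((-1) ^ n * (172 * of_nat n ^ 2 + 75 * of_nat n + 9) * of_nat ((3 * n) choose n) / of_int (2 ^ (12 * n)))"
    unfolding wz_G_0 by simp
  show ?thesis
    unfolding eq
    by (intro p_multiple_mult p_multiple_of_nat p_integral_divide_of_int p_integral_intros not_dvd_power_2 dvd)
qed

lemma sum_wz_G_0_p_multiple: "p_multiple p (\<Sum>n<p. wz_G n 0)"
proof -
  define N where "N = p div 4 + 1"
  have "odd p" using p p_gt_2 prime_odd_nat by blast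
  then obtain h where h: "p = 2 * h + 1" by (elim oddE)
  \<comment> \<open>Oddness gives \<open>p <= 4 * N\<close>, and also \<open>2 * N < p\<close>,
    which is tight for \<open>p = 3\<close> and \<open>p = 5\<close>.\<close>
  have N: "N > 0" "2 * N < p" "p \<le> 4 * N" using p_gt_2 \<open>odd p\<close> unfolding N_def by presburger+
  define S where "S k = (\<Sum>n<N. wz_G n k)" for k
  have S_Suc: "S (Suc k) = S k + wz_F N k" for k
  proof -
    have "S (Suc k) - S k = (\<Sum>n<N. wz_F (Suc n) k - wz_F n k)"
      unfolding S_def wz_pair by (simp add: sum_subtractf)
    also have "\<dots> = wz_F N k - wz_F 0 k" by (rule sum_lessThan_telescope)
    finally show ?thesis by (simp add: wz_F_0 algebra_simps)
  qed
  have S_eq: "S k = S 0 + (\<Sum>j<k. wz_F N j)" for k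
    by (induction k) (simp_all add: S_Suc)
  have "4 * n < p" if "n < N" for n
  proof -
    have "4 * n \<le> p" using that unfolding N_def by linarith
    moreover have "4 * n \<noteq> p" using \<open>odd p\<close> by auto
    ultimately show ?thesis by simp
  qed
  then have "p_multiple p (S h)"
    unfolding S_def using h by (intro p_multiple_sum wz_G_p_multiple) auto
  \<comment> \<open>For \<open>j < h\<close> one has \<open>2 * j + 1 < p\<close>, the bound that
    \<open>wz_F_p_multiple\<close> requires.\<close>
  moreover have "p_multiple p (\<Sum>j<h. wz_F N j)"
    using N h by (intro p_multiple_sum wz_F_p_multiple) auto
  ultimately have "p_multiple p (S h - (\<Sum>j<h. wz_F N j))"
    by (rule p_multiple_diff)
  then have S0: "p_multiple p (S 0)" by (simp add: S_eq[of h])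
  have "(\<Sum>n<p. wz_G n 0) = S 0 + (\<Sum>n\<in>{N..<p}. wz_G n 0)"
    unfolding S_def using N(2)
    by (subst sum.union_disjoint[symmetric]) (auto intro!: sum.cong)
  moreover have "p_multiple p (\<Sum>n\<in>{N..<p}. wz_G n 0)"
    using N by (intro p_multiple_sum wz_G_0_p_multiple) auto
  ultimately show ?thesis using S0 p_multiple_add by simp
qed

end

end

theorem theorem5:
  fixes p :: nat
  assumes "prime p" and "p > 2"
  shows "rat_cong p 1
    (\<Sum>n = 0..p - 1.
       (-1) ^ n * (172 * of_nat n ^ 2 + 75 * of_nat n + 9) / 2 ^ (12 * n)
       * of_nat ((4 * n) choose (2 * n)) * of_nat ((3 * n) choose n)
       * of_nat ((2 * n) choose n) ^ 3) 0"
proof -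
  have "{0..p - 1} = {..<p}" using assms(2) by auto
  then show ?thesis
    using p_multiple_imp_rat_cong[OF assms(1) sum_wz_G_0_p_multiple[OF assms]]
    by (simp only: wz_G_0)
qed

end
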